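(* Let $\{A_0,A_1,A_2,A_3\}$ be an orthocentric system in $\mathbb{R}^n$. Then for all $i,j,k,l$ with $\{i,j,k,l\}=\{0,1,2,3\}$, the vectors $\overrightarrow{A_iA_j}=A_j-A_i$ and $\overrightarrow{A_kA_l}=A_l-A_k$ are orthogonal.
   Context: $\mathbb{R}^n$ carries the standard Euclidean inner product and norm; two vectors are orthogonal if their inner product is $0$ (zero vectors allowed). For non-collinear points $X_0,X_1,X_2\in\mathbb{R}^n$, let $\mathcal{C}(\triangle X_0X_1X_2)$ be the set of points of $\mathbb{R}^n$ equidistant from $X_0,X_1,X_2$. Four points $\{A_0,A_1,A_2,A_3\}$ of $\mathbb{R}^n$ (listed in this order) form an orthocentric system if $A_0,A_1,A_2$ are non-collinear and there is a point $P\in\mathcal{C}(\triangle A_0A_1A_2)$ such that $A_3=A_0+A_1+A_2-2P$. *)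

theory Defs
  imports "HOL-Analysis.Analysis"
begin

(* Meant for non-collinear points.  In dimension n this is an affine subspace of
   dimension n - 2 orthogonal to the plane of the triangle, not a single point. *)
definition circumcenters ::
  "real ^ 'n \<Rightarrow> real ^ 'n \<Rightarrow> real ^ 'n \<Rightarrow> (real ^ 'n) set" where
  "circumcenters X0 X1 X2 = {P. dist P X0 = dist P X1 \<and> dist P X1 = dist P X2}"

(* The system is the family A 0, A 1, A 2, A 3; values of A at other indices are irrelevant. *)
definition orthocentric_system :: "(nat \<Rightarrow> real ^ 'n) \<Rightarrow> bool" where
  "orthocentric_system A \<longleftrightarrow>
     \<not> collinear {A 0, A 1, A 2} \<and>
     (\<exists>P \<in> circumcenters (A 0) (A 1) (A 2). A 3 = A 0 + A 1 + A 2 - 2 *\<^sub>R P)"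

end

theory Submission
  imports Defs
begin

(* If P is the centre used to define A 3, then A 3 - A k = (A i - P) + (A j - P) whenever
   {i, j, k} = {0, 1, 2}, whereas A j - A i = (A j - P) - (A i - P): the sum and the difference
   of two vectors of equal norm are orthogonal. *)

lemma orthogonal_diff_add_equidistant:
  fixes P X Y :: "'a::real_inner"
  assumes "dist P X = dist P Y"
  shows "orthogonal (Y - X) (X + Y - 2 *\<^sub>R P)"
proof -
  have "(X - P) \<bullet> (X - P) = (Y - P) \<bullet> (Y - P)"
    using assms by (simp add: dist_norm norm_minus_commute flip: power2_norm_eq_inner)
  \<comment> \<open>Expanded, the required inner product is the difference of these two
    squares.\<close>
  then show ?thesis
    by (simp add: orthogonal_def inner_simps inner_commute)
qed

text \<open>The formula for \<open>A 3\<close> is symmetric in the three vertices, so any labelling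
  of them by \<open>i\<close>, \<open>j\<close>, \<open>k\<close> is allowed. The theorem reduces to
  this case, where 3 is the last index.\<close>

lemma orthocentric_system_orthogonal_vertex3:
  fixes A :: "nat \<Rightarrow> real ^ 'n"
  assumes "orthocentric_system A" and ijk: "{i, j, k} = {0, 1, 2}"
  shows "orthogonal (A j - A i) (A 3 - A k)"
proof -
  obtain P where P: "dist P (A 0) = dist P (A 1)" "dist P (A 1) = dist P (A 2)"
    and A3: "A 3 = A 0 + A 1 + A 2 - 2 *\<^sub>R P"
    using assms(1) by (auto simp: orthocentric_system_def circumcenters_def)
  have "{i, j, k} \<subseteq> {0, 1, 2}"
    by (simp only: ijk subset_refl)
  then have "dist P (A i) = dist P (A j)"
    using P by auto
  \<comment> \<open>Three entries fill a set of three elements, so none repeats.\<close>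
  moreover have "card (set [i, j, k]) = length [i, j, k]"
    using ijk by simp
  then have distinct: "distinct [i, j, k]"
    by (rule card_distinct)
  \<comment> \<open>A sum over a set ignores order, which avoids going through the six
    permutations.\<close>
  have "A i + A j + A k = (\<Sum>m\<in>{i, j, k}. A m)"
    using distinct by (simp add: add.assoc)
  then have "A i + A j + A k = A 0 + A 1 + A 2"
    unfolding ijk by (simp add: add.assoc)
  then have "A 3 - A k = A i + A j - 2 *\<^sub>R P"
    unfolding A3 by (simp add: algebra_simps)
  ultimately show ?thesis
    by (simp add: orthogonal_diff_add_equidistant)
qed

theorem theorem4:
  fixes A :: "nat \<Rightarrow> real ^ 'n"
  assumes "orthocentric_system A"
  shows "\<forall>i j k l. {i, j, k, l} = {0, 1, 2, 3} \<longrightarrow> orthogonal (A j - A i) (A l - A k)"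
proof (intro allI impI)
  fix i j k l :: nat
  assume ijkl: "{i, j, k, l} = {0, 1, 2, 3}"
  have "card (set [i, j, k, l]) = length [i, j, k, l]"
    using ijkl by simp
  then have distinct: "distinct [i, j, k, l]"
    by (rule card_distinct)
  have rest: "{i, j, k, l} - {3} = {0, 1, 2}"
    unfolding ijkl by auto
  note vertex3 = orthocentric_system_orthogonal_vertex3[OF assms]
  have "3 \<in> {i, j, k, l}"
    unfolding ijkl by simp
  \<comment> \<open>Swapping the two vectors or reversing one keeps them orthogonal, so 3 can be
    moved to the last place.\<close>
  then consider "l = 3" | "k = 3" | "j = 3" | "i = 3"
    by auto
  then show "orthogonal (A j - A i) (A l - A k)"
  proof cases
    case 1
    \<comment> \<open>By distinctness, removing the index equal to 3 leaves exactly the other three,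
      as \<open>vertex3\<close> needs.\<close>
    have "{i, j, k} = {i, j, k, l} - {l}" using distinct by auto
    then show ?thesis using vertex3[of i j k] rest 1 by simp
  next
    case 2
    have "{i, j, l} = {i, j, k, l} - {k}" using distinct by auto
    then show ?thesis using vertex3[of i j l] rest 2
      by (simp add: orthogonal_def inner_diff_right)
  next
    case 3
    have "{k, l, i} = {i, j, k, l} - {j}" using distinct by auto
    then show ?thesis using vertex3[of k l i] rest 3
      by (simp add: orthogonal_commute)
  next
    case 4
    \<comment> \<open>Here both changes are needed: the vectors are swapped and
      \<open>A j - A i\<close> is reversed.\<close>
    have "{k, l, j} = {i, j, k, l} - {i}" using distinct by auto
    then show ?thesis using vertex3[of k l j] rest 4
      by (simp add: orthogonal_def inner_diff_left inner_diff_right inner_commute)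
  qed
qed

end
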